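(* Let $\ell\ge 1$ be a fixed integer and let $0<a<b$ be fixed real numbers. Then there exist $n_0$ and $A$ (depending only on $\ell,a,b$) such that for every integer $n\ge n_0$ and every integer $r$ with $n/2-b\sqrt n\le r\le n/2-a\sqrt n$, $$M_r^{(\le\ell)}(n)\le A\,n^{3/2}.$$
   Context: Let $\mathbb{F}=\{0,1\}$ and let $\mathbb{F}^n$ be the binary Hamming space (hypercube), with Hamming distance $d(x,y)$ = number of coordinates in which $x$ and $y$ differ. For $x\in\mathbb{F}^n$ put $B_r(x)=\{y\in\mathbb{F}^n: d(x,y)\le r\}$, and for $X\subseteq\mathbb{F}^n$ put $B_r(X)=\bigcup_{x\in X}B_r(x)$. A code is a nonempty subset $C\subseteq\mathbb{F}^n$; write $I_r(C;X)=B_r(X)\cap C$ (so $I_r(C;\emptyset)=\emptyset$). For non-negative integers $r,\ell$, a code $C\subseteq\mathbb{F}^n$ is $(r,\le\ell)$-identifying if $I_r(C;X)\ne I_r(C;Y)$ for all $X,Y\subseteq\mathbb{F}^n$ with $|X|\le\ell$, $|Y|\le\ell$ and $X\neq Y$ (the empty set is allowed as $X$ or $Y$). $M_r^{(\le\ell)}(n)$ denotes the smallest possible cardinality of an $(r,\le\ell)$-identifying code in $\mathbb{F}^n$; a bound $M_r^{(\le\ell)}(n)\le K$ means that an $(r,\le\ell)$-identifying code in $\mathbb{F}^n$ of size at most $K$ exists. *)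

theory Defs
  imports Complex_Main "HOL-Library.Extended_Real"
begin

definition hypercube :: "nat \<Rightarrow> bool list set" where
  "hypercube n = {x. length x = n}"

text \<open>Only meaningful for words of equal length.\<close>

definition hamming_dist :: "bool list \<Rightarrow> bool list \<Rightarrow> nat" where
  "hamming_dist x y = card {i. i < length x \<and> x ! i \<noteq> y ! i}"

definition hball :: "nat \<Rightarrow> nat \<Rightarrow> bool list \<Rightarrow> bool list set" where
  "hball n r x = {y \<in> hypercube n. hamming_dist x y \<le> r}"

definition hball_set :: "nat \<Rightarrow> nat \<Rightarrow> bool list set \<Rightarrow> bool list set" where
  "hball_set n r X = (\<Union>x\<in>X. hball n r x)"

definition is_code :: "nat \<Rightarrow> bool list set \<Rightarrow> bool" where
  "is_code n C \<longleftrightarrow> C \<noteq> {} \<and> C \<subseteq> hypercube n"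

definition I_set :: "nat \<Rightarrow> nat \<Rightarrow> bool list set \<Rightarrow> bool list set \<Rightarrow> bool list set" where
  "I_set n r C X = hball_set n r X \<inter> C"

definition identifying :: "nat \<Rightarrow> nat \<Rightarrow> nat \<Rightarrow> bool list set \<Rightarrow> bool" where
  "identifying n r l C \<longleftrightarrow> is_code n C \<and>
     (\<forall>X Y. X \<subseteq> hypercube n \<and> Y \<subseteq> hypercube n \<and> card X \<le> l \<and> card Y \<le> l \<and> X \<noteq> Y
        \<longrightarrow> I_set n r C X \<noteq> I_set n r C Y)"

text \<open>The minimum is taken in the extended naturals, so it is \<open>\<infinity>\<close> when no identifying code
  exists. An upper bound by a real number thus includes the existence of such a code.\<close>

definition M_ident :: "nat \<Rightarrow> nat \<Rightarrow> nat \<Rightarrow> enat" where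
  "M_ident r l n = (INF C\<in>{C. identifying n r l C}. enat (card C))"

end

theory Submission
  imports Defs "HOL-Library.Disjoint_Sets"
begin

text \<open>
  A code that meets every set \<open>B\<^sub>r(y) - B\<^sub>r(X)\<close> with \<open>|X| \<le> l\<close> and \<open>y \<notin> X\<close> is identifying. There are
  at most \<open>2 ^ ((n + 1) (l + 1))\<close> such sets, so if each has density at least \<open>c / sqrt n\<close>, a greedy
  choice of \<open>O(n \<cdot> sqrt n)\<close> words meets them all.

  For the density, encode a word \<open>w\<close> by the set \<open>Z\<close> of coordinates in which it differs from \<open>y\<close>, and
  let the atoms be the (at most \<open>2 ^ l\<close>) classes of coordinates that lie in the same difference sets
  of \<open>y\<close> with the elements of \<open>X\<close>. If \<open>|Z| = r\<close> and \<open>Z\<close> covers less than half of every atom, then \<open>w\<close>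
  has distance \<open>r\<close> from \<open>y\<close> and more than \<open>r\<close> from every element of \<open>X\<close>. To count such \<open>Z\<close>, let it be
  slightly below half on every atom except a largest one: this happens with probability bounded
  below. As \<open>r\<close> is at least \<open>a \<cdot> sqrt n\<close> below \<open>n / 2\<close>, the number of elements that remain for the
  largest atom is below half of it by \<open>\<Theta>(sqrt n)\<close>, and a binomial coefficient at that distance from
  the middle is a fraction of order \<open>1 / sqrt n\<close> of all subsets of the atom.
\<close>

section \<open>Binomial coefficients near the middle\<close>

text \<open>Consecutive central coefficients have ratio 2 (2h + 1) / (h + 1), while the lower bounds
  have ratio 4 sqrt (h / (h + 1)). The latter is smaller because 2 sqrt (h (h + 1)) <= 2h +
  1.\<close>

lemma central_binomial_ge:
  assumes "h > 0"
  shows "4 ^ h / (2 * sqrt (real h)) \<le> real ((2 * h) choose h)"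
  using assms
proof (induction h rule: nat_induct_non_zero)
  case 1
  show ?case by simp
next
  case (Suc h)
  have "Suc h * ((2 * Suc h) choose Suc h) = 2 * (2 * h + 1) * ((2 * h) choose h)"
  proof -
    have s: "Suc h * ((2 * Suc h) choose Suc h) = (2 * Suc h) * ((2 * h + 1) choose h)"
      using Suc_times_binomial_eq[of "2 * h + 1" h] by simp
    have "Suc h * ((2 * h + 1) choose h) = (2 * h + 1) * ((2 * h) choose h)"
      using binomial_absorb_comp[of "2 * h + 1" h] by simp
    hence "2 * Suc h * ((2 * h + 1) choose h) = 2 * ((2 * h + 1) * ((2 * h) choose h))"
      by (metis mult.assoc)
    thus ?thesis using s by (metis mult.assoc)
  qed
  hence "real (Suc h) * real ((2 * Suc h) choose Suc h)
      = 2 * (2 * real h + 1) * real ((2 * h) choose h)"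
    by (metis (mono_tags, opaque_lifting) of_nat_1 of_nat_add of_nat_mult of_nat_numeral)
  hence eq: "real ((2 * Suc h) choose Suc h)
      = 2 * (2 * real h + 1) / (real h + 1) * real ((2 * h) choose h)"
    by (simp add: field_simps)
  have "4 * real h * (real h + 1) \<le> (2 * real h + 1)\<^sup>2"
    by (simp add: power2_eq_square algebra_simps)
  hence "sqrt (4 * real h * (real h + 1)) \<le> 2 * real h + 1"
    by (intro real_le_lsqrt) auto
  hence sq: "2 * (sqrt (real h) * sqrt (real h + 1)) \<le> 2 * real h + 1"
    by (simp add: real_sqrt_mult)
  have s1: "sqrt (real h + 1) * sqrt (real h + 1) = real h + 1" by simp
  have pos: "sqrt (real h) > 0" "sqrt (real h + 1) > 0" using Suc.hyps by auto
  have "4 ^ Suc h / (2 * sqrt (real (Suc h))) = 4 * 4 ^ h / (2 * sqrt (real h + 1))"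
    by (simp add: add.commute)
  also have "\<dots> = (4 ^ h / (2 * sqrt (real h))) * (2 * (2 * (sqrt (real h) * sqrt (real h + 1)))
      / (real h + 1))"
  proof -
    have "4 * x / (2 * v) = x / (2 * u) * (2 * (2 * (u * v)) / (v * v))" if "u > 0" "v > 0" for u v x :: real
      using that by (simp add: field_simps)
    from this[OF pos, of "4 ^ h"] show ?thesis by (simp only: s1)
  qed
  also have "\<dots> \<le> (4 ^ h / (2 * sqrt (real h))) * (2 * (2 * real h + 1) / (real h + 1))"
    using sq by (intro mult_left_mono divide_right_mono) auto
  also have "\<dots> \<le> real ((2 * h) choose h) * (2 * (2 * real h + 1) / (real h + 1))"
    using Suc.IH by (intro mult_right_mono) auto
  also have "\<dots> = real ((2 * Suc h) choose Suc h)"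
    unfolding eq by simp
  finally show ?case .
qed

text \<open>The odd case reduces to the even one: for \<open>m = 2 * h + 1\<close> the middle
  coefficient is half of the central coefficient of \<open>m + 1\<close>.\<close>

lemma middle_binomial_ge:
  assumes "m > 0"
  shows "2 ^ m / (2 * sqrt (real m)) \<le> real (m choose (m div 2))"
proof (cases "even m")
  case True
  then obtain h where h: "m = 2 * h" by (elim evenE)
  have "(2::real) ^ m / (2 * sqrt (real m)) \<le> 4 ^ h / (2 * sqrt (real h))"
    using assms h by (simp add: power_mult frac_le)
  also have "\<dots> \<le> real (m choose (m div 2))"
    using central_binomial_ge[of h] assms h by simp
  finally show ?thesis .
next
  case False
  then obtain h where h: "m = 2 * h + 1" by (elim oddE)
  have "((2 * Suc h) choose Suc h) = 2 * (m choose h)"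
  proof -
    have "(2 * Suc h) choose Suc h = (m choose h) + (m choose Suc h)"
      using h by simp
    moreover have "m choose Suc h = m choose h"
      using binomial_symmetric[of h m] h by simp
    ultimately show ?thesis by simp
  qed
  hence c: "4 * 4 ^ h / (2 * sqrt (real (Suc h))) \<le> 2 * real (m choose h)"
    using central_binomial_ge[of "Suc h"] by simp
  have "(2::real) ^ m / (2 * sqrt (real m)) \<le> 2 ^ m / (2 * sqrt (real (Suc h)))"
    using h by (intro divide_left_mono) auto
  also have "\<dots> = 4 * 4 ^ h / (2 * sqrt (real (Suc h))) / 2"
    using h by (simp add: power_mult)
  also have "\<dots> \<le> real (m choose (m div 2))" using c h by simp
  finally show ?thesis .
qed

lemma exp_minus_twice_le:
  fixes u :: real
  assumes "0 \<le> u" "u \<le> 1 / 2"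
  shows "exp (- 2 * u) \<le> 1 - u"
proof -
  have "u * u \<le> u * (1 / 2)" using assms by (intro mult_left_mono) auto
  hence "- 2 * u \<le> ln (1 - u)"
    using ln_one_minus_pos_lower_bound[OF assms] by (simp add: power2_eq_square)
  thus ?thesis using assms by (subst (asm) ln_ge_iff) auto
qed

text \<open>One step down from \<open>k + 1\<close> to \<open>k\<close> multiplies the coefficient
  by (k + 1) / (m - k), which is at least 1 - 4B / sqrt m as long as \<open>k\<close> is at least m
  / 2 - B sqrt m. The hypothesis \<open>large\<close> keeps this bound positive, so that the factors
  can be multiplied.\<close>

lemma binomial_below_middle_ge:
  fixes B :: real
  assumes m: "m > 0" and B: "0 \<le> B" and large: "8 * B \<le> sqrt (real m)"
    and t: "t \<le> m div 2" "real m / 2 - B * sqrt (real m) \<le> real (m div 2 - t)"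
  shows "(1 - 4 * B / sqrt (real m)) ^ t * real (m choose (m div 2)) \<le> real (m choose (m div 2 - t))"
  using t
proof (induction t)
  case 0
  show ?case by simp
next
  case (Suc t)
  define s where "s = sqrt (real m)"
  define k where "k = m div 2 - Suc t"
  have s: "s > 0" "s * s = real m" using m by (auto simp: s_def)
  have k: "m div 2 - t = Suc k" "k \<le> m" using Suc.prems by (auto simp: k_def)
  have kB: "real m / 2 - B * s \<le> real k" using Suc.prems by (simp add: k_def s_def)
  have k2: "2 * k + 2 \<le> m" using k by linarith
  have IH: "(1 - 4 * B / s) ^ t * real (m choose (m div 2)) \<le> real (m choose Suc k)"
    using Suc.IH Suc.prems k kB by (simp add: s_def)
  have "Suc k * (m choose Suc k) = (m - k) * (m choose k)"
    by (simp only: binomial_absorption binomial_absorb_comp)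
  hence "real (Suc k) * real (m choose Suc k) = (real m - real k) * real (m choose k)"
    using k by (metis of_nat_diff of_nat_mult)
  hence eq: "real (m choose k) = (real k + 1) / (real m - real k) * real (m choose Suc k)"
    using k2 by (simp add: field_simps)
  have u: "4 * B / s \<le> 1 / 2" using large s by (simp add: s_def field_simps)
  have "(1 - 4 * B / s) * (real m - real k) \<le> real k + 1"
  proof -
    have "real m - 2 * real k \<le> 4 * B / s * (real m / 2)"
    proof -
      have "4 * B / s * (real m / 2) = 2 * B * s"
        using s(1) by (simp add: s(2)[symmetric])
      thus ?thesis using kB by simp
    qed
    also have "\<dots> \<le> 4 * B / s * (real m - real k)"
      using k2 B s by (intro mult_left_mono) auto
    finally show ?thesis by (simp add: algebra_simps)
  qed
  hence r: "1 - 4 * B / s \<le> (real k + 1) / (real m - real k)"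
    using k2 by (simp add: pos_le_divide_eq)
  have "(1 - 4 * B / s) ^ Suc t * real (m choose (m div 2))
      = (1 - 4 * B / s) * ((1 - 4 * B / s) ^ t * real (m choose (m div 2)))" by simp
  also have "\<dots> \<le> (real k + 1) / (real m - real k) * real (m choose Suc k)"
    using r IH u k2 by (intro mult_mono) auto
  also have "\<dots> = real (m choose k)" using eq by simp
  finally show ?case by (simp add: k_def s_def)
qed

text \<open>At most B sqrt m steps lead from the middle down to \<open>k\<close>, and each keeps at
  least a factor exp (-8B / sqrt m), so only a constant factor is lost in total.\<close>

lemma binomial_near_middle_ge:
  fixes B :: real
  assumes B: "0 \<le> B"
  obtains c :: real where "0 < c"
    "\<And>m k. \<lbrakk>0 < m; real m / 2 - B * sqrt (real m) \<le> real k; 2 * k \<le> m\<rbrakk>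
      \<Longrightarrow> c * 2 ^ m / sqrt (real m) \<le> real (m choose k)"
proof
  \<comment> \<open>The first value serves large \<open>m\<close>. The second serves the
    \<open>m\<close> with sqrt m < 8B, where \<open>2 ^ m\<close> is bounded and a coefficient of at
    least 1 is enough.\<close>
  define c where "c = min (exp (- 8 * B\<^sup>2) / 2) (2 powr - (64 * B\<^sup>2))"
  show "0 < c" by (simp add: c_def)
  fix m k :: nat
  assume m: "0 < m" and kB: "real m / 2 - B * sqrt (real m) \<le> real k" and k: "2 * k \<le> m"
  define s where "s = sqrt (real m)"
  have s: "s > 0" "s * s = real m" "s \<ge> 1" using m by (auto simp: s_def)
  show "c * 2 ^ m / sqrt (real m) \<le> real (m choose k)"
  proof (cases "8 * B \<le> s")
    case True
    define t where "t = m div 2 - k"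
    have t: "t \<le> m div 2" "m div 2 - t = k" using k by (auto simp: t_def)
    have tB: "real t \<le> B * s"
    proof -
      have "real t = real (m div 2) - real k" using k by (simp add: t_def)
      moreover have "real (m div 2) \<le> real m / 2" by linarith
      ultimately show ?thesis using kB by (simp add: s_def)
    qed
    have "exp (- 8 * B\<^sup>2) \<le> exp (- 2 * (4 * B / s)) ^ t"
    proof -
      have "4 * B / s * real t \<le> 4 * B / s * (B * s)"
        using tB B s by (intro mult_left_mono) auto
      hence "4 * B / s * real t \<le> 4 * B\<^sup>2"
        using s by (simp add: power2_eq_square)
      moreover have "exp (- 2 * (4 * B / s)) ^ t = exp (- 2 * (4 * B / s * real t))"
        by (simp add: exp_of_nat_mult[symmetric] mult_ac)
      ultimately show ?thesis by simp
    qed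
    also have "\<dots> \<le> (1 - 4 * B / s) ^ t"
      using True s B by (intro power_mono exp_minus_twice_le) (auto simp: field_simps)
    finally have e: "exp (- 8 * B\<^sup>2) \<le> (1 - 4 * B / s) ^ t" .
    have "c * 2 ^ m / s \<le> exp (- 8 * B\<^sup>2) / 2 * 2 ^ m / s"
      using s by (intro divide_right_mono mult_right_mono) (auto simp: c_def)
    also have "\<dots> = exp (- 8 * B\<^sup>2) * (2 ^ m / (2 * s))" by simp
    also have "\<dots> \<le> (1 - 4 * B / s) ^ t * real (m choose (m div 2))"
      using e middle_binomial_ge[OF m] s by (intro mult_mono) (auto simp: s_def intro!: order.trans[OF exp_ge_zero e[unfolded s_def]])
    also have "\<dots> \<le> real (m choose k)"
      using binomial_below_middle_ge[OF m B, of t] True t kB by (simp add: s_def)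
    finally show ?thesis by (simp add: s_def)
  next
    case False
    have "s * s \<le> (8 * B) * (8 * B)" using False s by (intro mult_mono) auto
    hence "real m \<le> 64 * B\<^sup>2" by (simp add: s power2_eq_square)
    hence "(2::real) ^ m \<le> 2 powr (64 * B\<^sup>2)"
      by (simp add: powr_realpow[symmetric])
    hence "c * 2 ^ m \<le> 2 powr - (64 * B\<^sup>2) * 2 powr (64 * B\<^sup>2)"
      by (intro mult_mono) (auto simp: c_def)
    hence "c * 2 ^ m \<le> 1" by (simp add: powr_add[symmetric])
    hence "c * 2 ^ m / s \<le> 1" using s by (simp add: field_simps)
    also have "1 \<le> real (m choose k)" using k by (simp add: Suc_leI)
    finally show ?thesis by (simp add: s_def)
  qed
qed

section \<open>Subsets with slightly less than half of the elements\<close>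

lemma card_subsets_with_card_in:
  assumes "finite A" "finite T"
  shows "card {Z. Z \<subseteq> A \<and> card Z \<in> T} = (\<Sum>k\<in>T. card A choose k)"
proof -
  have "{Z. Z \<subseteq> A \<and> card Z \<in> T} = (\<Union>k\<in>T. {Z. Z \<subseteq> A \<and> card Z = k})" by auto
  also have "card \<dots> = (\<Sum>k\<in>T. card {Z. Z \<subseteq> A \<and> card Z = k})"
    using assms by (intro card_UN_disjoint) (auto intro: finite_subset[of _ "Pow A"])
  finally show ?thesis using assms by (simp add: n_subsets)
qed

text \<open>The window contains on the order of sqrt m sizes, and each contributes a fraction of
  order 1 / sqrt m of all subsets. The term -1 keeps the window nonempty for small sets: the largest
  integer strictly below m / 2 can be 1 below it.\<close>

lemma card_subsets_slightly_below_half_ge: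
  fixes d :: real
  assumes d: "0 < d"
  obtains c :: real where "0 < c" "c \<le> 1"
    "\<And>A :: 'a set. \<lbrakk>finite A; A \<noteq> {}\<rbrakk> \<Longrightarrow>
      c * 2 ^ card A \<le> real (card {Z. Z \<subseteq> A \<and> 2 * card Z < card A \<and>
        real (card A) / 2 - 1 - d * sqrt (real (card A)) \<le> real (card Z)})"
proof -
  \<comment> \<open>The 1 in \<open>1 + d\<close> absorbs the term -1 of the window, since sqrt m >=
    1.\<close>
  obtain c0 where c0: "c0 > 0" and bin: "\<And>m k. \<lbrakk>0 < m; real m / 2 - (1 + d) * sqrt (real m) \<le> real k;
      2 * k \<le> m\<rbrakk> \<Longrightarrow> c0 * 2 ^ m / sqrt (real m) \<le> real (m choose k)"
    using binomial_near_middle_ge[of "1 + d"] d by auto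
  define c where "c = min 1 (c0 * min (1 / 2) d)"
  show ?thesis
  proof
    show "0 < c" "c \<le> 1" using c0 d by (auto simp: c_def)
    fix A :: "'a set" assume A: "finite A" "A \<noteq> {}"
    define m where "m = card A"
    define s where "s = sqrt (real m)"
    \<comment> \<open>\<open>h\<close> is the largest integer strictly below m / 2. The cap of
      \<open>q\<close> by \<open>h\<close> stops the window at 0; when it applies, the window has
      \<open>h + 1\<close> sizes, which is at least half of sqrt m. This is where
      \<open>1 / 2\<close> in \<open>c\<close> comes from.\<close>
    define h where "h = (m - 1) div 2"
    define q where "q = min h (nat \<lfloor>d * s\<rfloor>)"
    define T where "T = {h - q..h}"
    have m: "m > 0" using A by (simp add: m_def card_gt_0_iff)
    have s: "s > 0" "s * s = real m" "s \<ge> 1" using m by (auto simp: s_def)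
    have "s * 1 \<le> s * s" using s by (intro mult_left_mono) auto
    hence sm: "s \<le> real m" using s by simp
    have h: "2 * h < m" "real m / 2 - 1 \<le> real h" using m by (auto simp: h_def)
    have fl: "d * s < real (nat \<lfloor>d * s\<rfloor>) + 1" "real (nat \<lfloor>d * s\<rfloor>) \<le> d * s"
      using d s by (auto simp: of_nat_nat)
    have cardT: "card T = q + 1" by (auto simp: T_def q_def)
    have "min (1 / 2) d * s \<le> real (card T)"
    proof (cases "h \<le> nat \<lfloor>d * s\<rfloor>")
      case True
      have "min (1 / 2) d * s \<le> 1 / 2 * s" using s by (intro mult_right_mono) auto
      thus ?thesis using True h sm by (simp add: cardT q_def)
    next
      case False
      have "min (1 / 2) d * s \<le> d * s" using s by (intro mult_right_mono) auto
      thus ?thesis using False fl(1) by (simp add: cardT q_def del: of_nat_nat)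
    qed
    have T: "2 * k < m" "real m / 2 - 1 - d * s \<le> real k" if "k \<in> T" for k
    proof -
      show "2 * k < m" using that h by (auto simp: T_def)
      have "real h - real q \<le> real k" using that by (auto simp: T_def)
      moreover have "real q \<le> d * s" using fl by (auto simp: q_def min_def)
      ultimately show "real m / 2 - 1 - d * s \<le> real k" using h by linarith
    qed
    have "c * 2 ^ m \<le> (c0 * min (1 / 2) d) * 2 ^ m"
      by (intro mult_right_mono) (auto simp: c_def)
    also have "\<dots> = (min (1 / 2) d * s) * (c0 * 2 ^ m / s)" using s by simp
    also have "\<dots> \<le> real (card T) * (c0 * 2 ^ m / s)"
      using \<open>min (1 / 2) d * s \<le> real (card T)\<close> c0 s by (intro mult_right_mono) auto
    also have "\<dots> \<le> (\<Sum>k\<in>T. real (m choose k))"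
    proof (intro sum_bounded_below)
      fix k assume k: "k \<in> T"
      have "real m / 2 - (1 + d) * s \<le> real k"
        using T(2)[OF k] s(3) by (simp add: distrib_right)
      thus "c0 * 2 ^ m / s \<le> real (m choose k)"
        unfolding s_def using T(1)[OF k] by (intro bin m) auto
    qed
    also have "\<dots> = real (card {Z. Z \<subseteq> A \<and> card Z \<in> T})"
      using card_subsets_with_card_in[OF A(1), of T] by (simp add: m_def T_def)
    also have "\<dots> \<le> real (card {Z. Z \<subseteq> A \<and> 2 * card Z < card A \<and>
        real (card A) / 2 - 1 - d * sqrt (real (card A)) \<le> real (card Z)})"
      using T A by (intro of_nat_mono card_mono) (auto simp: m_def s_def)
    finally show "c * 2 ^ card A \<le> \<dots>" by (simp add: m_def)
  qed
qed

section \<open>Levels of the cube and partitions of the coordinates\<close>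

text \<open>Conditions on disjoint blocks are independent: a subset of the union is a free choice of
  its traces on the blocks, so the densities multiply.\<close>

lemma card_subsets_of_disjoint_Union_ge:
  fixes c :: real
  assumes "finite P" "disjoint P" "\<And>A. A \<in> P \<Longrightarrow> finite A" "0 \<le> c"
    "\<And>A. A \<in> P \<Longrightarrow> c * 2 ^ card A \<le> real (card {Z. Z \<subseteq> A \<and> Q A Z})"
  shows "c ^ card P * 2 ^ card (\<Union>P) \<le> real (card {Z. Z \<subseteq> \<Union>P \<and> (\<forall>A\<in>P. Q A (Z \<inter> A))})"
  using assms
proof (induction P rule: finite_induct)
  case empty
  have "{Z. Z \<subseteq> \<Union>{} \<and> (\<forall>A\<in>{}. Q A (Z \<inter> A))} = {{}}" by auto
  thus ?case by simp
next
  case (insert A P)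
  define F where "F = {Z. Z \<subseteq> A \<and> Q A Z}"
  define G where "G = {Z. Z \<subseteq> \<Union>P \<and> (\<forall>A\<in>P. Q A (Z \<inter> A))}"
  have dis: "A \<inter> \<Union>P = {}" "A \<inter> B = {}" if "B \<in> P" for B
    using insert.prems(1) insert.hyps(2) that by (auto simp: disjoint_def)
  have dis': "A \<inter> \<Union>P = {}" using dis by blast
  have fin: "finite A" "finite (\<Union>P)" using insert.prems(2) insert.hyps(1) by auto
  have IH: "c ^ card P * 2 ^ card (\<Union>P) \<le> real (card G)"
    unfolding G_def using insert.prems by (intro insert.IH) (auto simp: disjoint_def)
  have "c ^ card (insert A P) * 2 ^ card (\<Union>(insert A P))
      = (c * 2 ^ card A) * (c ^ card P * 2 ^ card (\<Union>P))"
    using insert.hyps fin dis' by (simp add: card_Un_disjoint power_add)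
  also have "\<dots> \<le> real (card F) * real (card G)"
    using IH insert.prems by (intro mult_mono) (auto simp: F_def)
  also have "\<dots> = real (card (F \<times> G))" by (simp add: card_cartesian_product)
  also have "\<dots> = real (card ((\<lambda>(X, Y). X \<union> Y) ` (F \<times> G)))"
  proof -
    have "inj_on (\<lambda>(X, Y). X \<union> Y) (F \<times> G)"
      using dis' by (intro inj_on_inverseI[where g = "\<lambda>W. (W \<inter> A, W \<inter> \<Union>P)"]) (auto simp: F_def G_def)
    thus ?thesis by (simp add: card_image)
  qed
  also have "\<dots> \<le> real (card {Z. Z \<subseteq> \<Union>(insert A P) \<and> (\<forall>B\<in>insert A P. Q B (Z \<inter> B))})"
  proof (intro of_nat_mono card_mono)
    show "finite {Z. Z \<subseteq> \<Union>(insert A P) \<and> (\<forall>B\<in>insert A P. Q B (Z \<inter> B))}"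
      by (rule finite_subset[of _ "Pow (A \<union> \<Union>P)"]) (blast, simp add: fin del: finite_Union)
    have "X \<union> Y \<in> {Z. Z \<subseteq> \<Union>(insert A P) \<and> (\<forall>B\<in>insert A P. Q B (Z \<inter> B))}"
      if "X \<in> F" "Y \<in> G" for X Y
    proof -
      have "(X \<union> Y) \<inter> A = X" using that dis' by (auto simp: F_def G_def)
      moreover have "(X \<union> Y) \<inter> B = Y \<inter> B" if "B \<in> P" for B
        using \<open>X \<in> F\<close> dis(2)[OF that] by (auto simp: F_def)
      ultimately show ?thesis using that by (auto simp: F_def G_def)
    qed
    thus "(\<lambda>(X, Y). X \<union> Y) ` (F \<times> G) \<subseteq> {Z. Z \<subseteq> \<Union>(insert A P) \<and> (\<forall>B\<in>insert A P. Q B (Z \<inter> B))}"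
      by fast
  qed
  finally show ?case .
qed

lemma card_eq_sum_card_Int:
  assumes "finite P" "disjoint P" "finite Z" "Z \<subseteq> \<Union>P"
  shows "card Z = (\<Sum>A\<in>P. card (Z \<inter> A))"
proof -
  have "Z = (\<Union>A\<in>P. Z \<inter> A)" using assms(4) by auto
  also have "card \<dots> = (\<Sum>A\<in>P. card (Z \<inter> A))"
    using assms by (intro card_UN_disjoint) (auto simp: disjoint_def)
  finally show ?thesis .
qed

text \<open>The traces on all blocks except a largest one, of size M, are taken from the window just
  below half. Their total deficit is less than a sqrt n, so the number left for the largest block is
  below M / 2. It is below by at most b sqrt n, which is of order sqrt M, so the bound near the
  middle applies.\<close>

lemma card_level_below_half_on_partition_ge:
  fixes a b :: real and L :: nat
  assumes a: "0 < a" and b: "0 < b"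
  obtains c :: real and n0 :: nat where "0 < c"
    "\<And>(V :: 'a set) P r. \<lbrakk>finite V; partition_on V P; card P \<le> L; n0 \<le> card V;
        real (card V) / 2 - b * sqrt (real (card V)) \<le> real r;
        real r \<le> real (card V) / 2 - a * sqrt (real (card V))\<rbrakk>
      \<Longrightarrow> c * 2 ^ card V / sqrt (real (card V))
        \<le> real (card {Z. Z \<subseteq> V \<and> card Z = r \<and> (\<forall>A\<in>P. 2 * card (Z \<inter> A) < card A)})"
proof -
  \<comment> \<open>Each of at most \<open>L\<close> blocks loses at most 1 + d sqrt n. This
    \<open>d\<close> makes the terms d sqrt n sum to at most half of a sqrt n; the other half
    absorbs the rounding losses.\<close>
  define d where "d = a / (2 * (real L + 1))"
  have d: "0 < d" using a by (simp add: d_def)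
  define Q where "Q = (\<lambda>(A :: 'a set) (Z :: 'a set). 2 * card Z < card A \<and>
      real (card A) / 2 - 1 - d * sqrt (real (card A)) \<le> real (card Z))"
  obtain c1 where c1: "0 < c1" "c1 \<le> 1" and window: "\<And>A :: 'a set. \<lbrakk>finite A; A \<noteq> {}\<rbrakk> \<Longrightarrow>
      c1 * 2 ^ card A \<le> real (card {Z. Z \<subseteq> A \<and> Q A Z})"
  proof -
    show thesis
      by (rule card_subsets_slightly_below_half_ge[OF d, where 'a = 'a]) (rule that[unfolded Q_def])
  qed
  obtain c2 where c2: "0 < c2" and bin: "\<And>m k. \<lbrakk>0 < m; real m / 2 - (b * real L) * sqrt (real m) \<le> real k;
      2 * k \<le> m\<rbrakk> \<Longrightarrow> c2 * 2 ^ m / sqrt (real m) \<le> real (m choose k)"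
  proof -
    have "0 \<le> b * real L" using b by simp
    thus thesis by (rule binomial_near_middle_ge) (rule that)
  qed
  \<comment> \<open>The first summand makes \<open>a / 2 * s\<close> exceed the rounding loss
    \<open>L\<close>, the second makes half of the largest block at least \<open>b * s\<close>, and
    the last keeps \<open>V\<close> nonempty.\<close>
  define s0 where "s0 = 2 * real L / a + 2 * real L * b + 1"
  show ?thesis
  proof
    show "0 < c1 ^ L * c2" using c1 c2 by simp
    fix V :: "'a set" and P r
    assume V: "finite V" and P: "partition_on V P" "card P \<le> L" and n0: "nat \<lceil>s0\<^sup>2\<rceil> \<le> card V"
      and rb: "real (card V) / 2 - b * sqrt (real (card V)) \<le> real r"
      and ra: "real r \<le> real (card V) / 2 - a * sqrt (real (card V))"
    define n where "n = card V"
    define s where "s = sqrt (real n)"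
    have "s0\<^sup>2 \<le> real n" using n0 by (simp add: n_def)
    hence s_ge: "s0 \<le> s" unfolding s_def by (intro real_le_rsqrt)
    have s0: "1 \<le> s0" "2 * real L / a < s0" "2 * real L * b \<le> s0"
      using a b by (simp_all add: s0_def add_nonneg_pos add_pos_nonneg)
    have s: "s \<ge> 1" "s * s = real n" using s_ge s0(1) by (linarith, simp add: s_def)
    have P': "\<Union>P = V" "disjoint P" "{} \<notin> P" using P by (auto simp: partition_on_def)
    have finP: "finite P" using finite_elements[OF V P(1)] .
    have finA: "finite A" if "A \<in> P" for A using that V P' by (auto intro: finite_subset)
    have "P \<noteq> {}" using P' s by (auto simp: n_def)
    define M where "M = Max (card ` P)"
    have "M \<in> card ` P" unfolding M_def using finP \<open>P \<noteq> {}\<close> by (intro Max_in) auto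
    then obtain A0 where A0: "A0 \<in> P" "card A0 = M" by auto
    have maxM: "card A \<le> M" if "A \<in> P" for A unfolding M_def using that finP by auto
    define P1 where "P1 = P - {A0}"
    define V1 where "V1 = \<Union>P1"
    have P1: "finite P1" "disjoint P1" "P1 \<subseteq> P" "card P1 \<le> L"
      using finP P P'(2) card_mono[of P P1] by (auto simp: P1_def disjoint_def)
    have A0V1: "A0 \<inter> V1 = {}" "A0 \<union> V1 = V"
      using P' A0 by (auto simp: V1_def P1_def disjoint_def)
    have A0A: "A0 \<inter> A = {}" if "A \<in> P1" for A using that A0V1 by (auto simp: V1_def)
    have finV1: "finite V1" using V A0V1 by (auto intro: finite_subset)
    have n: "n = M + card V1"
      using A0V1 A0 finV1 finA[OF A0(1)] by (metis card_Un_disjoint n_def)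
    have "n = (\<Sum>A\<in>P. card A)"
      unfolding n_def P'(1)[symmetric] using finA P'(2)
      by (intro card_Union_disjoint) (auto simp: disjoint_def pairwise_def disjnt_def)
    also have "\<dots> \<le> (\<Sum>A\<in>P. M)" by (intro sum_mono maxM)
    also have "\<dots> \<le> L * M" using P by simp
    finally have nLM: "real n \<le> real L * real M" by (metis of_nat_le_iff of_nat_mult)
    have M: "0 < M" "0 < L" using nLM s by (auto simp: not_less intro!: gr0I)
    \<comment> \<open>This ensures \<open>card Z \<le> r\<close> below, so that the subtraction
      \<open>r - card Z\<close> is not truncated.\<close>
    have bs: "2 * (b * s) \<le> real M"
    proof -
      have "real L * (2 * (b * s)) = (2 * real L * b) * s" by simp
      also have "\<dots> \<le> s * s" using s0 s_ge s by (intro mult_right_mono) auto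
      also have "\<dots> \<le> real L * real M" using nLM s by simp
      finally show ?thesis using M by simp
    qed
    \<comment> \<open>A largest block has at least n / L elements, so deviations of order sqrt n are
      also of order sqrt M.\<close>
    have sM: "s \<le> real L * sqrt (real M)"
    proof -
      have "real n \<le> (real L * real L) * real M"
        using nLM M by (auto intro!: order.trans[OF nLM] mult_right_mono)
      hence "s \<le> sqrt ((real L * real L) * real M)" by (simp add: s_def)
      thus ?thesis by (simp add: real_sqrt_mult)
    qed
    have sqM: "0 < sqrt (real M)" "sqrt (real M) \<le> s" using M n by (auto simp: s_def)
    define G where "G = {Z. Z \<subseteq> V1 \<and> (\<forall>A\<in>P1. Q A (Z \<inter> A))}"
    have finG: "finite G" using finV1 by (auto simp: G_def)
    have G: "card Z \<le> r" "2 * (r - card Z) < M" "c2 * 2 ^ M / s \<le> real (M choose (r - card Z))"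
      if "Z \<in> G" for Z
    proof -
      have Z: "Z \<subseteq> V1" "\<And>A. A \<in> P1 \<Longrightarrow> Q A (Z \<inter> A)" using that by (auto simp: G_def)
      have cZ: "real (card Z) = (\<Sum>A\<in>P1. real (card (Z \<inter> A)))"
        using card_eq_sum_card_Int[OF P1(1,2), of Z] Z finV1 by (auto simp: V1_def finite_subset)
      have cV1: "real (card V1) = (\<Sum>A\<in>P1. real (card A))"
        using card_eq_sum_card_Int[OF P1(1,2) finV1]
        by (auto simp: V1_def Int_absorb1 Sup_upper intro!: sum.cong)
      have "(\<Sum>A\<in>P1. real (card (Z \<inter> A))) \<le> (\<Sum>A\<in>P1. real (card A) / 2)"
        using Z by (intro sum_mono) (force simp: Q_def)
      hence up: "real (card Z) \<le> real (card V1) / 2"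
        by (simp add: cZ cV1 sum_divide_distrib)
      have "(\<Sum>A\<in>P1. real (card A) / 2 - (1 + d * s)) \<le> (\<Sum>A\<in>P1. real (card (Z \<inter> A)))"
      proof (intro sum_mono)
        fix A assume A: "A \<in> P1"
        have "sqrt (real (card A)) \<le> s"
          unfolding s_def n_def using A P1 P' V by (auto intro!: card_mono)
        hence "d * sqrt (real (card A)) \<le> d * s" using d by (intro mult_left_mono) auto
        thus "real (card A) / 2 - (1 + d * s) \<le> real (card (Z \<inter> A))"
          using Z(2)[OF A] by (simp add: Q_def)
      qed
      hence lo: "real (card V1) / 2 - real (card P1) * (1 + d * s) \<le> real (card Z)"
        by (simp add: cZ cV1 sum_divide_distrib sum_subtractf)
      have "real (card P1) * (1 + d * s) \<le> real L * (1 + d * s)"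
        using P1 d s by (intro mult_right_mono) auto
      also have "\<dots> < a * s"
      proof -
        have "real L * d \<le> a / 2" using a by (simp add: d_def field_simps)
        hence "real L * d * s \<le> a / 2 * s" using s by (intro mult_right_mono) auto
        moreover have "2 * real L / a < s" using s0 s_ge by simp
        hence "real L < a / 2 * s" using a by (simp add: field_simps)
        ultimately show ?thesis by (simp add: algebra_simps)
      qed
      finally have lo': "real (card V1) / 2 - a * s < real (card Z)" using lo by simp
      have r: "real n / 2 - b * s \<le> real r" "real r \<le> real n / 2 - a * s"
        using ra rb by (auto simp: s_def n_def)
      have nr: "real n = real M + real (card V1)" using n by simp
      have "real (card Z) \<le> real r" using up r nr bs by argo
      thus "card Z \<le> r" by simp
      hence k: "real (r - card Z) = real r - real (card Z)" by simp
      show half: "2 * (r - card Z) < M" using k lo' r nr by linarith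
      have "b * s \<le> b * (real L * sqrt (real M))" using sM b by (intro mult_left_mono) auto
      hence "real M / 2 - (b * real L) * sqrt (real M) \<le> real (r - card Z)"
        unfolding mult.assoc using k up r nr by argo
      hence "c2 * 2 ^ M / sqrt (real M) \<le> real (M choose (r - card Z))"
        using half M by (intro bin) auto
      moreover have "c2 * 2 ^ M / s \<le> c2 * 2 ^ M / sqrt (real M)"
        using sqM c2 s(1) by (intro divide_left_mono mult_pos_pos) auto
      ultimately show "c2 * 2 ^ M / s \<le> real (M choose (r - card Z))" by simp
    qed
    \<comment> \<open>Each admissible trace \<open>Z\<close> outside \<open>A0\<close> is completed
      inside \<open>A0\<close> to a set of size exactly \<open>r\<close>.\<close>
    define W where "W = (SIGMA Z:G. {Y. Y \<subseteq> A0 \<and> card Y = r - card Z})"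
    have "c1 ^ L * 2 ^ card V1 \<le> c1 ^ card P1 * 2 ^ card V1"
      using c1 P1 by (intro mult_right_mono power_decreasing) auto
    also have "\<dots> \<le> real (card G)"
      unfolding G_def V1_def using P1 finA c1 window P'
      by (intro card_subsets_of_disjoint_Union_ge) auto
    finally have cG: "c1 ^ L * 2 ^ card V1 \<le> real (card G)" .
    have "c1 ^ L * c2 * 2 ^ n / s = (c1 ^ L * 2 ^ card V1) * (c2 * 2 ^ M / s)"
      using n by (simp add: power_add)
    also have "\<dots> \<le> real (card G) * (c2 * 2 ^ M / s)"
      using cG c2 s by (intro mult_right_mono) auto
    also have "\<dots> \<le> (\<Sum>Z\<in>G. real (M choose (r - card Z)))"
      using G by (intro sum_bounded_below) auto
    also have "\<dots> = (\<Sum>Z\<in>G. real (card {Y. Y \<subseteq> A0 \<and> card Y = r - card Z}))"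
      using A0 finA by (simp add: n_subsets)
    also have "\<dots> = real (card W)"
      unfolding W_def using finG finA[OF A0(1)] by (subst card_SigmaI) auto
    also have "card W = card ((\<lambda>(Z, Y). Z \<union> Y) ` W)"
    proof -
      have "inj_on (\<lambda>(Z, Y). Z \<union> Y) W"
        using A0V1 by (intro inj_on_inverseI[where g = "\<lambda>X. (X \<inter> V1, X \<inter> A0)"])
          (auto simp: W_def G_def)
      thus ?thesis by (simp add: card_image)
    qed
    also have "\<dots> \<le> card {Z. Z \<subseteq> V \<and> card Z = r \<and> (\<forall>A\<in>P. 2 * card (Z \<inter> A) < card A)}"
    proof (intro card_mono subsetI)
      show "finite {Z. Z \<subseteq> V \<and> card Z = r \<and> (\<forall>A\<in>P. 2 * card (Z \<inter> A) < card A)}"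
        using V by simp
      fix X assume "X \<in> (\<lambda>(Z, Y). Z \<union> Y) ` W"
      then obtain Z Y where X: "X = Z \<union> Y" and Z: "Z \<in> G" and Y: "Y \<subseteq> A0" "card Y = r - card Z"
        by (auto simp: W_def)
      have ZV1: "Z \<subseteq> V1" using Z by (simp add: G_def)
      have fin: "finite Z" "finite Y" using ZV1 Y finV1 finA[OF A0(1)] by (auto intro: finite_subset)
      have "Z \<inter> Y = {}" using ZV1 Y A0V1 by auto
      hence "card X = r" using X Y fin G(1)[OF Z] by (simp add: card_Un_disjoint)
      moreover have "2 * card (X \<inter> A) < card A" if "A \<in> P" for A
      proof (cases "A = A0")
        case True
        have "X \<inter> A0 = Y" using X Y ZV1 A0V1 by auto
        thus ?thesis using True G(2)[OF Z] Y A0 by simp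
      next
        case False
        hence A: "A \<in> P1" using that by (simp add: P1_def)
        hence "X \<inter> A = Z \<inter> A" using X Y A0A[OF A] by auto
        thus ?thesis using Z A by (auto simp: G_def Q_def)
      qed
      ultimately show "X \<in> {Z. Z \<subseteq> V \<and> card Z = r \<and> (\<forall>A\<in>P. 2 * card (Z \<inter> A) < card A)}"
        using X Y ZV1 A0V1 by auto
    qed
    finally show "c1 ^ L * c2 * 2 ^ card V / sqrt (real (card V))
        \<le> real (card {Z. Z \<subseteq> V \<and> card Z = r \<and> (\<forall>A\<in>P. 2 * card (Z \<inter> A) < card A)})"
      by (simp add: n_def s_def)
  qed
qed

text \<open>\<open>D\<close> is a disjoint union of blocks, so the inequalities on these blocks add
  up. Strictness survives because a nonempty \<open>D\<close> contains at least one block.\<close>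

lemma card_Int_less_half_of_atoms:
  assumes P: "finite P" "disjoint P" "{} \<notin> P" and D: "finite D" "D \<noteq> {}" "D = \<Union>{A \<in> P. A \<subseteq> D}"
    and Z: "\<And>A. A \<in> P \<Longrightarrow> 2 * card (Z \<inter> A) < card A"
  shows "2 * card (Z \<inter> D) < card D"
proof -
  let ?R = "{A \<in> P. A \<subseteq> D}"
  have R: "finite ?R" "disjoint ?R" "?R \<noteq> {}" using P D(2,3) by (auto simp: disjoint_def)
  have ZD: "Z \<inter> D \<subseteq> \<Union>?R" using D(3) by blast
  have "card (Z \<inter> D) = (\<Sum>A\<in>?R. card (Z \<inter> D \<inter> A))"
    using R(1,2) D(1) ZD by (intro card_eq_sum_card_Int) auto
  also have "\<dots> = (\<Sum>A\<in>?R. card (Z \<inter> A))"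
    by (intro sum.cong refl arg_cong[of _ _ card]) auto
  finally have 1: "card (Z \<inter> D) = (\<Sum>A\<in>?R. card (Z \<inter> A))" .
  have "card D = (\<Sum>A\<in>?R. card (D \<inter> A))"
    using R(1,2) D(1) equalityD1[OF D(3)] by (intro card_eq_sum_card_Int) auto
  also have "\<dots> = (\<Sum>A\<in>?R. card A)"
    by (intro sum.cong refl arg_cong[of _ _ card]) auto
  finally have 2: "card D = (\<Sum>A\<in>?R. card A)" .
  have "(\<Sum>A\<in>?R. 2 * card (Z \<inter> A)) < (\<Sum>A\<in>?R. card A)"
    using R Z by (intro sum_strict_mono) auto
  thus ?thesis unfolding 1 2 by (simp add: sum_distrib_left)
qed

section \<open>Differences of Hamming balls\<close>

lemma finite_hypercube: "finite (hypercube n)"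
  and card_hypercube: "card (hypercube n) = 2 ^ n"
  using finite_lists_length_eq[of "UNIV :: bool set" n] card_lists_length_eq[of "UNIV :: bool set" n]
  by (auto simp: hypercube_def)

section \<open>Words encoded by the coordinates in which they differ from a centre\<close>

definition diff_coords :: "bool list \<Rightarrow> bool list \<Rightarrow> nat set" where
  "diff_coords y x = {i. i < length y \<and> x ! i \<noteq> y ! i}"

text \<open>Translation of \<open>y\<close> by the indicator vector of \<open>Z\<close>: on
  Booleans, \<open>\<noteq>\<close> is exclusive or.\<close>

definition flip :: "bool list \<Rightarrow> nat set \<Rightarrow> bool list" where
  "flip y Z = map (\<lambda>i. y ! i \<noteq> (i \<in> Z)) [0..<length y]"

lemma flip_in_hypercube: "y \<in> hypercube n \<Longrightarrow> flip y Z \<in> hypercube n"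
  by (simp add: flip_def hypercube_def)

lemma inj_on_flip: "inj_on (flip y) (Pow {..<length y})"
proof (rule inj_onI)
  fix Z Z' assume Z: "Z \<in> Pow {..<length y}" "Z' \<in> Pow {..<length y}" and eq: "flip y Z = flip y Z'"
  have "i \<in> Z \<longleftrightarrow> i \<in> Z'" if "i < length y" for i
    using arg_cong[OF eq, of "\<lambda>w. w ! i"] that by (auto simp: flip_def)
  thus "Z = Z'" using Z by auto
qed

text \<open>The two words differ exactly on the symmetric difference of \<open>Z\<close> and
  \<open>diff_coords y x\<close>. Hence their distance exceeds \<open>card Z\<close> if and only if
  \<open>Z\<close> covers less than half of \<open>diff_coords y x\<close>. The additive form avoids
  truncated subtraction.\<close>

lemma hamming_dist_flip:
  assumes "length x = length y" "Z \<subseteq> {..<length y}"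
  shows "hamming_dist x (flip y Z) + 2 * card (Z \<inter> diff_coords y x)
    = card Z + card (diff_coords y x)"
proof -
  let ?D = "diff_coords y x"
  have fin: "finite Z" "finite ?D" using assms by (auto simp: diff_coords_def intro: finite_subset)
  have "{i. i < length x \<and> x ! i \<noteq> flip y Z ! i} = (Z - ?D) \<union> (?D - Z)"
    using assms by (auto simp: flip_def diff_coords_def)
  hence "hamming_dist x (flip y Z) = card (Z - ?D) + card (?D - Z)"
    using fin by (simp add: hamming_dist_def card_Un_disjoint disjoint_iff)
  moreover have "card Z = card (Z - ?D) + card (Z \<inter> ?D)" "card ?D = card (?D - Z) + card (Z \<inter> ?D)"
    using fin card_Diff_subset_Int[of Z ?D] card_Diff_subset_Int[of ?D Z]
      card_mono[of Z "Z \<inter> ?D"] card_mono[of ?D "Z \<inter> ?D"] by (auto simp: Int_commute)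
  ultimately show ?thesis by simp
qed

text \<open>The constants are uniform in \<open>r\<close>, \<open>X\<close> and \<open>y\<close>
  because the number of atoms is at most \<open>2 ^ l\<close>.\<close>

lemma card_hball_minus_hball_set_ge:
  fixes a b :: real and l :: nat
  assumes "0 < a" "0 < b"
  obtains c :: real and n0 :: nat where "0 < c"
    "\<And>n r X y. \<lbrakk>n0 \<le> n; real n / 2 - b * sqrt (real n) \<le> real r; real r \<le> real n / 2 - a * sqrt (real n);
        X \<subseteq> hypercube n; card X \<le> l; y \<in> hypercube n; y \<notin> X\<rbrakk>
      \<Longrightarrow> c * 2 ^ n / sqrt (real n) \<le> real (card (hball n r y - hball_set n r X))"
proof -
  obtain c n0 where c: "0 < c" and level: "\<And>(V :: nat set) P r. \<lbrakk>finite V; partition_on V P;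
        card P \<le> 2 ^ l; n0 \<le> card V;
        real (card V) / 2 - b * sqrt (real (card V)) \<le> real r;
        real r \<le> real (card V) / 2 - a * sqrt (real (card V))\<rbrakk>
      \<Longrightarrow> c * 2 ^ card V / sqrt (real (card V))
        \<le> real (card {Z. Z \<subseteq> V \<and> card Z = r \<and> (\<forall>A\<in>P. 2 * card (Z \<inter> A) < card A)})"
  proof -
    show thesis
      by (rule card_level_below_half_on_partition_ge[OF assms, of "2 ^ l"]) (rule that)
  qed
  show ?thesis
  proof
    show "0 < c" by fact
    fix n r X y
    assume n0: "n0 \<le> n" and r: "real n / 2 - b * sqrt (real n) \<le> real r"
        "real r \<le> real n / 2 - a * sqrt (real n)"
      and X: "X \<subseteq> hypercube n" "card X \<le> l" and y: "y \<in> hypercube n" "y \<notin> X"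
    define V where "V = {..<n}"
    \<comment> \<open>\<open>f i\<close> records which words of \<open>X\<close> differ from
      \<open>y\<close> at coordinate \<open>i\<close>; its fibres are the atoms.\<close>
    define f where "f = (\<lambda>i. {x \<in> X. i \<in> diff_coords y x})"
    define P where "P = (\<lambda>j. {i \<in> V. f i = j}) ` f ` V"
    define T where "T = {Z. Z \<subseteq> V \<and> card Z = r \<and> (\<forall>A\<in>P. 2 * card (Z \<inter> A) < card A)}"
    have leny: "length y = n" using y by (simp add: hypercube_def)
    have finX: "finite X" using X(1) finite_hypercube by (rule finite_subset)
    have part: "partition_on V P"
      by (auto simp: partition_on_def P_def disjoint_def)
    have P: "finite P" "disjoint P" "{} \<notin> P"
      using part finite_elements[OF _ part] by (auto simp: partition_on_def V_def)
    have "card P \<le> card (f ` V)" unfolding P_def by (intro card_image_le) (simp add: V_def)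
    also have "\<dots> \<le> card (Pow X)" using finX by (intro card_mono) (auto simp: f_def)
    also have "\<dots> \<le> 2 ^ l" using X finX by (simp add: card_Pow)
    finally have cP: "card P \<le> 2 ^ l" .
    have "c * 2 ^ n / sqrt (real n) \<le> real (card T)"
      using level[OF _ part cP, of r] n0 r by (simp add: V_def T_def)
    also have "card T = card (flip y ` T)"
    proof -
      have "T \<subseteq> Pow {..<length y}" using leny by (auto simp: V_def T_def)
      thus ?thesis by (metis card_image inj_on_flip inj_on_subset)
    qed
    also have "\<dots> \<le> card (hball n r y - hball_set n r X)"
    proof (intro card_mono subsetI)
      show "finite (hball n r y - hball_set n r X)"
        by (rule finite_subset[OF _ finite_hypercube[of n]]) (auto simp: hball_def)
      fix w assume "w \<in> flip y ` T"
      then obtain Z where w: "w = flip y Z" and Z: "Z \<in> T" by auto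
      have ZV: "Z \<subseteq> {..<length y}" "card Z = r" using Z leny by (auto simp: T_def V_def)
      have wn: "w \<in> hypercube n" using y w by (simp add: flip_in_hypercube)
      \<comment> \<open>This is the distance formula with \<open>y\<close> in place of
        \<open>x\<close>, where the difference set is empty.\<close>
      have "hamming_dist y w = r"
        using hamming_dist_flip[of y y Z] ZV w by (simp add: diff_coords_def)
      hence "w \<in> hball n r y" using wn by (simp add: hball_def)
      moreover have "hamming_dist x w > r" if x: "x \<in> X" for x
      proof -
        define D where "D = diff_coords y x"
        have lenx: "length x = length y" using x X leny by (auto simp: hypercube_def)
        have DV: "D \<subseteq> V" using leny by (auto simp: D_def diff_coords_def V_def)
        have "D \<noteq> {}"
        proof
          assume "D = {}"
          hence "x = y" using lenx by (auto simp: D_def diff_coords_def intro: nth_equalityI)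
          thus False using x y by simp
        qed
        have mem: "i \<in> D \<longleftrightarrow> x \<in> f i" for i using x by (simp add: f_def D_def)
        \<comment> \<open>Membership of \<open>i\<close> in \<open>D\<close> depends only on
          \<open>f i\<close>, so \<open>D\<close> is a union of atoms.\<close>
        have D: "D = \<Union>{A \<in> P. A \<subseteq> D}"
        proof (intro equalityI subsetI)
          fix i assume i: "i \<in> D"
          have "{i' \<in> V. f i' = f i} \<in> P" using i DV by (auto simp: P_def)
          moreover have "{i' \<in> V. f i' = f i} \<subseteq> D" using i mem by auto
          moreover have "i \<in> {i' \<in> V. f i' = f i}" using i DV by auto
          ultimately show "i \<in> \<Union>{A \<in> P. A \<subseteq> D}" by blast
        qed auto
        have "finite D" using DV by (rule finite_subset) (simp add: V_def)
        have atoms: "2 * card (Z \<inter> A) < card A" if "A \<in> P" for A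
          using Z that unfolding T_def by blast
        have "2 * card (Z \<inter> D) < card D"
          by (rule card_Int_less_half_of_atoms[OF P \<open>finite D\<close> \<open>D \<noteq> {}\<close> D atoms])
        thus ?thesis
          using hamming_dist_flip[OF lenx ZV(1)] ZV w by (simp add: D_def)
      qed
      hence "w \<notin> hball_set n r X" by (force simp: hball_set_def hball_def)
      ultimately show "w \<in> hball n r y - hball_set n r X" by simp
    qed
    finally show "c * 2 ^ n / sqrt (real n) \<le> real (card (hball n r y - hball_set n r X))"
      by simp
  qed
qed

section \<open>Hitting sets and identifying codes\<close>

text \<open>By averaging, some point of \<open>U\<close> lies in at least a proportion
  \<open>p\<close> of the sets not yet hit. Adding it to \<open>C\<close> multiplies the number of
  unhit sets by at most \<open>1 - p\<close>.\<close>

lemma greedy_hitting: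
  fixes F :: "'i set" and S :: "'i \<Rightarrow> 'a set" and p :: real
  assumes "finite U" "U \<noteq> {}" "finite F" "p \<le> 1"
    and S: "\<And>i. i \<in> F \<Longrightarrow> p * real (card U) \<le> real (card (S i \<inter> U))"
  shows "\<exists>C\<subseteq>U. card C \<le> K \<and> real (card {i \<in> F. S i \<inter> C = {}}) \<le> (1 - p) ^ K * real (card F)"
proof (induction K)
  case 0
  show ?case by (intro exI[of _ "{}"]) auto
next
  case (Suc K)
  then obtain C where C: "C \<subseteq> U" "card C \<le> K"
    and b: "real (card {i \<in> F. S i \<inter> C = {}}) \<le> (1 - p) ^ K * real (card F)" by auto
  define G where "G = {i \<in> F. S i \<inter> C = {}}"
  have finG: "finite G" using assms by (simp add: G_def)
  \<comment> \<open>Double counting of the pairs of a point of \<open>U\<close> and an unhit set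
    that contains it.\<close>
  have "(\<Sum>u\<in>U. p * real (card G)) = (\<Sum>i\<in>G. p * real (card U))" by simp
  also have "\<dots> \<le> (\<Sum>i\<in>G. real (card (S i \<inter> U)))"
    using S by (intro sum_mono) (auto simp: G_def)
  also have "\<dots> = (\<Sum>i\<in>G. \<Sum>u\<in>U. of_bool (u \<in> S i))"
    using assms(1) by (simp add: Int_commute)
  also have "\<dots> = (\<Sum>u\<in>U. \<Sum>i\<in>G. of_bool (u \<in> S i))" by (rule sum.swap)
  also have "\<dots> = (\<Sum>u\<in>U. real (card {i \<in> G. u \<in> S i}))"
    using finG by (simp add: Int_def)
  finally obtain u where u: "u \<in> U" "p * real (card G) \<le> real (card {i \<in> G. u \<in> S i})"
    using assms(1,2) by (meson not_le sum_strict_mono)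
  have "card G = card {i \<in> G. u \<in> S i} + card {i \<in> G. u \<notin> S i}"
    using finG by (subst card_Un_disjoint[symmetric]) (auto intro: arg_cong[of _ _ card])
  hence "real (card {i \<in> G. u \<notin> S i}) \<le> (1 - p) * real (card G)"
    using u by (simp add: algebra_simps)
  also have "\<dots> \<le> (1 - p) * ((1 - p) ^ K * real (card F))"
    using b assms by (intro mult_left_mono) (auto simp: G_def)
  finally have "real (card {i \<in> G. u \<notin> S i}) \<le> (1 - p) ^ Suc K * real (card F)" by simp
  moreover have "{i \<in> F. S i \<inter> insert u C = {}} = {i \<in> G. u \<notin> S i}" by (auto simp: G_def)
  moreover have "card (insert u C) \<le> Suc K"
    using C assms(1) by (simp add: card_insert_if finite_subset)
  ultimately show ?case using C u by (intro exI[of _ "insert u C"]) auto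
qed

text \<open>Since (1 - p)^K <= exp (-p K), the hypothesis on \<open>K\<close> leaves fewer than one
  unhit set after \<open>K\<close> greedy choices, hence none.\<close>

lemma exists_hitting_set:
  fixes F :: "'i set" and S :: "'i \<Rightarrow> 'a set" and p :: real
  assumes "finite U" "U \<noteq> {}" "finite F" "p \<le> 1"
    and S: "\<And>i. i \<in> F \<Longrightarrow> p * real (card U) \<le> real (card (S i \<inter> U))"
    and K: "real (card F) < exp (p * real K)"
  obtains C where "C \<subseteq> U" "card C \<le> K" "\<And>i. i \<in> F \<Longrightarrow> S i \<inter> C \<noteq> {}"
proof -
  obtain C where C: "C \<subseteq> U" "card C \<le> K"
    and b: "real (card {i \<in> F. S i \<inter> C = {}}) \<le> (1 - p) ^ K * real (card F)"
    using greedy_hitting[of U F p S K, OF assms(1-4) S] by auto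
  have "(1 - p) ^ K \<le> exp (- p) ^ K"
    using assms(4) exp_ge_add_one_self[of "- p"] by (intro power_mono) auto
  hence "(1 - p) ^ K \<le> exp (- (p * real K))" by (simp add: exp_of_nat_mult[symmetric] mult.commute)
  hence "(1 - p) ^ K * real (card F) \<le> exp (- (p * real K)) * real (card F)"
    by (intro mult_right_mono) auto
  also have "\<dots> < exp (- (p * real K)) * exp (p * real K)" using K by simp
  also have "\<dots> = 1" by (simp add: exp_minus)
  finally have "card {i \<in> F. S i \<inter> C = {}} = 0" using b by simp
  hence "S i \<inter> C \<noteq> {}" if "i \<in> F" for i using assms(3) that by auto
  with C that show ?thesis by blast
qed

text \<open>A crude recursion is enough: a set with at most \<open>l + 1\<close> elements has at
  most \<open>l\<close>, or arises from such a set by inserting a point.\<close>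

lemma card_small_subsets_le:
  assumes "finite U"
  shows "card {X. X \<subseteq> U \<and> card X \<le> l} \<le> Suc (card U) ^ l"
proof (induction l)
  case 0
  have "{X. X \<subseteq> U \<and> card X \<le> 0} = {{}}" using assms by (auto dest: finite_subset)
  thus ?case by simp
next
  case (Suc l)
  let ?S = "{X. X \<subseteq> U \<and> card X \<le> l}"
  have fin: "finite ?S" using assms by simp
  have "{X. X \<subseteq> U \<and> card X \<le> Suc l} \<subseteq> ?S \<union> (\<lambda>(u, X). insert u X) ` (U \<times> ?S)"
  proof
    fix X assume "X \<in> {X. X \<subseteq> U \<and> card X \<le> Suc l}"
    hence X: "X \<subseteq> U" "card X \<le> Suc l" by auto
    show "X \<in> ?S \<union> (\<lambda>(u, X). insert u X) ` (U \<times> ?S)"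
    proof (cases "X = {}")
      case False
      then obtain u where u: "u \<in> X" by auto
      have "(u, X - {u}) \<in> U \<times> ?S" "X = insert u (X - {u})"
        using u X by auto
      thus ?thesis by (auto intro!: image_eqI[of _ _ "(u, X - {u})"])
    qed auto
  qed
  hence "card {X. X \<subseteq> U \<and> card X \<le> Suc l} \<le> card (?S \<union> (\<lambda>(u, X). insert u X) ` (U \<times> ?S))"
    using assms fin by (intro card_mono) auto
  also have "\<dots> \<le> card ?S + card (U \<times> ?S)"
    using assms fin by (intro order.trans[OF card_Un_le] add_left_mono card_image_le) auto
  also have "\<dots> = Suc (card U) * card ?S" by (simp add: card_cartesian_product)
  also have "\<dots> \<le> Suc (card U) ^ Suc l" using Suc.IH by (simp only: power_Suc mult_le_mono2)
  finally show ?case .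
qed

text \<open>Of two distinct sets, one contains a \<open>y\<close> outside the other. A codeword in
  the ball around \<open>y\<close> but in no ball around the other set distinguishes the
  two.\<close>

lemma identifyingI:
  assumes C: "C \<subseteq> hypercube n"
    and sep: "\<And>X y. \<lbrakk>X \<subseteq> hypercube n; card X \<le> l; y \<in> hypercube n; y \<notin> X\<rbrakk>
      \<Longrightarrow> (hball n r y - hball_set n r X) \<inter> C \<noteq> {}"
  shows "identifying n r l C"
proof -
  have one: "\<not> I_set n r C Y \<subseteq> I_set n r C X"
    if "X \<subseteq> hypercube n" "card X \<le> l" "y \<in> hypercube n" "y \<in> Y" "y \<notin> X" for X Y y
    using sep[OF that(1,2,3,5)] that(4) by (auto simp: I_set_def hball_set_def)
  have "I_set n r C X \<noteq> I_set n r C Y"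
    if XY: "X \<subseteq> hypercube n" "Y \<subseteq> hypercube n" "card X \<le> l" "card Y \<le> l" "X \<noteq> Y" for X Y
  proof (cases "Y \<subseteq> X")
    case True
    then obtain x where "x \<in> X" "x \<notin> Y" using XY by auto
    thus ?thesis using one[of Y x X] XY by auto
  next
    case False
    then obtain y where "y \<in> Y" "y \<notin> X" by auto
    thus ?thesis using one[of X y Y] XY by auto
  qed
  \<comment> \<open>Separating a single word from the empty \<open>X\<close> already requires a
    codeword.\<close>
  moreover have "C \<noteq> {}"
    using sep[of "{}" "replicate n False"] by (auto simp: hypercube_def)
  ultimately show ?thesis using C by (auto simp: identifying_def is_code_def)
qed

theorem theorem4:
  fixes l :: nat and a b :: real
  assumes "l \<ge> 1" and "0 < a" and "a < b"
  shows "\<exists>(n0 :: nat) (A :: real). \<forall>(n :: nat) (r :: nat).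
           n \<ge> n0 \<and>
           real n / 2 - b * sqrt (real n) \<le> real r \<and>
           real r \<le> real n / 2 - a * sqrt (real n)
           \<longrightarrow> ereal_of_enat (M_ident r l n) \<le> ereal (A * real n powr (3 / 2))"
proof -
  have "0 < b" using assms by simp
  obtain c n0 where c: "0 < c" and dens: "\<And>n r X y. \<lbrakk>n0 \<le> n;
        real n / 2 - b * sqrt (real n) \<le> real r; real r \<le> real n / 2 - a * sqrt (real n);
        X \<subseteq> hypercube n; card X \<le> l; y \<in> hypercube n; y \<notin> X\<rbrakk>
      \<Longrightarrow> c * 2 ^ n / sqrt (real n) \<le> real (card (hball n r y - hball_set n r X))"
  proof -
    show thesis by (rule card_hball_minus_hball_set_ge[OF assms(2) \<open>0 < b\<close>]) (rule that)
  qed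
  \<comment> \<open>As n + 1 <= 2n, the first summand covers \<open>N / p\<close>; the 1 pays for
    rounding \<open>K\<close> up to an integer.\<close>
  define A where "A = 2 * real (l + 1) / c + 1"
  have "ereal_of_enat (M_ident r l n) \<le> ereal (A * real n powr (3 / 2))"
    if n: "max n0 1 \<le> n" and r: "real n / 2 - b * sqrt (real n) \<le> real r"
      "real r \<le> real n / 2 - a * sqrt (real n)" for n r
  proof -
    define U where "U = hypercube n"
    define s where "s = sqrt (real n)"
    define p where "p = c / s"
    define F where "F = {(X, y). X \<subseteq> U \<and> card X \<le> l \<and> y \<in> U \<and> y \<notin> X}"
    define S where "S = (\<lambda>(X, y). hball n r y - hball_set n r X)"
    \<comment> \<open>\<open>2 ^ N\<close> will bound the number of pairs in \<open>F\<close>, and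
      \<open>K\<close> is the least integer with p K >= N. The quotient \<open>N / p\<close> is of
      order n^(3/2).\<close>
    define N where "N = (n + 1) * (l + 1)"
    define K where "K = nat \<lceil>real N / p\<rceil>"
    have s: "s \<ge> 1" using n by (simp add: s_def)
    have p: "p > 0" using c s by (simp add: p_def)
    have U: "finite U" "card U = 2 ^ n" "U \<noteq> {}"
      using card_hypercube[of n] finite_hypercube[of n] by (auto simp: U_def)
    have S: "p * real (card U) \<le> real (card (S i \<inter> U))" if "i \<in> F" for i
    proof -
      obtain X y where i: "i = (X, y)" "X \<subseteq> U" "card X \<le> l" "y \<in> U" "y \<notin> X"
        using \<open>i \<in> F\<close> by (auto simp: F_def)
      have "S i \<inter> U = S i" by (auto simp: S_def i U_def hball_def)
      thus ?thesis using dens[of n r X y] n r i U by (simp add: p_def s_def S_def U_def)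
    qed
    \<comment> \<open>As \<open>F\<close> is nonempty, the density bound for one of its members
      gives \<open>p \<le> 1\<close>, which the greedy choice requires.\<close>
    have "({}, replicate n False) \<in> F" by (auto simp: F_def U_def hypercube_def)
    from S[OF this] have "p * real (card U) \<le> real (card U)"
      by (rule order.trans) (use U(1) in \<open>auto intro!: card_mono\<close>)
    hence p1: "p \<le> 1" using U by simp
    have Fsub: "F \<subseteq> {X. X \<subseteq> U \<and> card X \<le> l} \<times> U" by (auto simp: F_def)
    have finF: "finite F" using U by (intro finite_subset[OF Fsub]) auto
    have "card F \<le> card {X. X \<subseteq> U \<and> card X \<le> l} * card U"
      using U card_mono[OF _ Fsub] by (simp add: card_cartesian_product)
    also have "\<dots> \<le> Suc (2 ^ n) ^ l * 2 ^ n"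
      using card_small_subsets_le[OF U(1), of l] U by simp
    also have "\<dots> \<le> (2 ^ (n + 1)) ^ l * 2 ^ (n + 1)"
      by (intro mult_mono power_mono) auto
    also have "\<dots> = 2 ^ N" by (simp only: N_def power_mult power_add power_one_right)
    finally have "real (card F) \<le> 2 ^ N"
      by (metis of_nat_le_iff of_nat_numeral of_nat_power)
    \<comment> \<open>The Taylor bound gives e >= 5/2 > 2, and \<open>N\<close> is positive, so the
      inequality is strict.\<close>
    also have "\<dots> < exp 1 ^ N"
      using exp_lower_Taylor_quadratic[of 1] by (intro power_strict_mono) (auto simp: N_def)
    also have "\<dots> = exp (real N)" by (simp add: exp_of_nat_mult[symmetric])
    also have "\<dots> \<le> exp (p * real K)"
    proof -
      have "real N / p \<le> real K" unfolding K_def by linarith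
      thus ?thesis using p by (simp add: field_simps)
    qed
    finally have F: "real (card F) < exp (p * real K)" .
    obtain C where C: "C \<subseteq> U" "card C \<le> K" "\<And>i. i \<in> F \<Longrightarrow> S i \<inter> C \<noteq> {}"
    proof -
      show thesis by (rule exists_hitting_set[OF U(1,3) finF p1 S F]) (assumption, rule that)
    qed
    have "identifying n r l C"
      using C(1) C(3) by (intro identifyingI) (auto simp: U_def F_def S_def)
    hence "M_ident r l n \<le> enat (card C)"
      unfolding M_ident_def by (intro INF_lower) simp
    also have "\<dots> \<le> enat K" using C by simp
    finally have "ereal_of_enat (M_ident r l n) \<le> ereal_of_enat (enat K)"
      by (simp only: ereal_of_enat_le_iff)
    hence "ereal_of_enat (M_ident r l n) \<le> ereal (real K)" by simp
    also have "real K \<le> A * real n powr (3 / 2)"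
    proof -
      have "0 \<le> real N / p" using p by simp
      hence "real K \<le> real N / p + 1" unfolding K_def by linarith
      also have "\<dots> = (real n + 1) * real (l + 1) / c * s + 1"
      proof -
        have "real N = (real n + 1) * real (l + 1)"
          unfolding N_def by (simp only: of_nat_mult of_nat_add of_nat_1)
        thus ?thesis by (simp add: p_def)
      qed
      also have "\<dots> \<le> (2 * real n) * real (l + 1) / c * s + real n * s"
      proof (intro add_mono mult_right_mono divide_right_mono)
        show "1 \<le> real n * s" using n s mult_mono[of 1 "real n" 1 s] by simp
      qed (use n c s in auto)
      also have "\<dots> = A * (real n * s)" by (simp add: A_def algebra_simps)
      also have "real n * s = real n powr (3 / 2)"
      proof -
        have "real n powr (3 / 2) = real n powr (1 + 1 / 2)" by simp
        also have "\<dots> = real n * s" using n by (simp only: powr_add) (simp add: powr_half_sqrt s_def)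
        finally show ?thesis by simp
      qed
      finally show ?thesis .
    qed
    finally show ?thesis by simp
  qed
  thus ?thesis by (intro exI[of _ "max n0 1"] exI[of _ A]) auto
qed

end
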